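(* Let $(\mathcal{X},\mathcal{C})$ be a nonzero ordered Banach space and let $T$ be a positive linear map on $\mathcal{X}$ (i.e. a bounded linear map $T:\mathcal{X}\to\mathcal{X}$ with $T\mathcal{C}\subseteq\mathcal{C}$), with spectral radius $r(T)$ and spectrum $\sigma(T)$. Then $r(T)\in\sigma(T)$, and there exists a sequence $\{x_n\}_{n=1}^\infty\subseteq\mathcal{C}$ with $\|x_n\|=1$ for all $n$ such that $$\lim_{n\to\infty}\|Tx_n-r(T)x_n\|=0 .$$
   Context: An ordered Banach space $(\mathcal{X},\mathcal{C})$ is a complex Banach space $\mathcal{X}$ with a closed positive cone $\mathcal{C}\subseteq\mathcal{X}$ (closed under multiplication by nonnegative real scalars) such that $\mathcal{C}\cap(-\mathcal{C})=\{0\}$ and $\mathcal{C}+\mathcal{C}\subseteq\mathcal{C}$. One writes $x\le y$ if $y-x\in\mathcal{C}$. Moreover the cone satisfies: (1) there is a constant $c_{\mathcal{X}}>0$ such that $0\le x\le y$ implies $\|x\|\le c_{\mathcal{X}}\|y\|$; (2) there is a constant $d_{\mathcal{X}}>0$ such that each $x\in\mathcal{X}$ is a linear sum of four positive elements with norms bounded by $d_{\mathcal{X}}\|x\|$, i.e. $x=x_1-x_2+i(x_3-x_4)$ with $x_k\in\mathcal{C}$, $\|x_k\|\le d_{\mathcal{X}}\|x\|$. *)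

theory Defs
  imports "HOL-Analysis.Analysis"
begin

class scaleC =
  fixes scaleC :: "complex \<Rightarrow> 'a \<Rightarrow> 'a"  (infixr "*\<^sub>C" 75)

text \<open>The library has only real vector spaces. A complex vector space is a real one with a
  complex scalar multiplication that restricts to the given real one, so that the real norm,
  topology and \<^const>\<open>bounded_linear\<close> of the library remain applicable.\<close>

class complex_vector = real_vector + scaleC +
  assumes scaleC_add_right: "a *\<^sub>C (x + y) = a *\<^sub>C x + a *\<^sub>C y"
    and scaleC_add_left: "(a + b) *\<^sub>C x = a *\<^sub>C x + b *\<^sub>C x"
    and scaleC_scaleC: "a *\<^sub>C (b *\<^sub>C x) = (a * b) *\<^sub>C x"
    and scaleC_one: "1 *\<^sub>C x = x"
    and scaleC_of_real: "complex_of_real r *\<^sub>C x = r *\<^sub>R x"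

class complex_normed_vector = complex_vector + real_normed_vector +
  assumes norm_scaleC: "norm (a *\<^sub>C x) = cmod a * norm x"

class complex_banach = complex_normed_vector + banach

definition bounded_clinear :: "('a::complex_normed_vector \<Rightarrow> 'b::complex_normed_vector) \<Rightarrow> bool"
  where "bounded_clinear T \<longleftrightarrow> bounded_linear T \<and> (\<forall>a x. T (a *\<^sub>C x) = a *\<^sub>C T x)"

definition op_spectrum :: "('a::complex_normed_vector \<Rightarrow> 'a) \<Rightarrow> complex set"
  where "op_spectrum T =
    {z. \<not> (\<exists>S. bounded_clinear S \<and> (\<forall>x. S (z *\<^sub>C x - T x) = x) \<and> (\<forall>x. z *\<^sub>C S x - T (S x) = x))}"

text \<open>The spectrum of a bounded operator on a nonzero complex Banach space is nonempty and
  compact, so the supremum below is a genuine one there; for an empty or unbounded spectrum the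
  value carries no meaning.\<close>

definition op_spectral_radius :: "('a::complex_normed_vector \<Rightarrow> 'a) \<Rightarrow> real"
  where "op_spectral_radius T = (SUP z\<in>op_spectrum T. cmod z)"

definition cone_le :: "'a::real_vector set \<Rightarrow> 'a \<Rightarrow> 'a \<Rightarrow> bool"
  where "cone_le C x y \<longleftrightarrow> y - x \<in> C"

locale ordered_banach_space =
  fixes C :: "'a::complex_banach set"
  assumes closed_cone: "closed C"
    and cone: "cone C"
    and pointed: "C \<inter> uminus ` C = {0}"
    and add_closed: "\<lbrakk>x \<in> C; y \<in> C\<rbrakk> \<Longrightarrow> x + y \<in> C"
    and normal: "\<exists>c>0. \<forall>x y. cone_le C 0 x \<and> cone_le C x y \<longrightarrow> norm x \<le> c * norm y"
    and generating: "\<exists>d>0. \<forall>x. \<exists>x1\<in>C. \<exists>x2\<in>C. \<exists>x3\<in>C. \<exists>x4\<in>C.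
      x = x1 - x2 + \<i> *\<^sub>C (x3 - x4) \<and>
      norm x1 \<le> d * norm x \<and> norm x2 \<le> d * norm x \<and> norm x3 \<le> d * norm x \<and> norm x4 \<le> d * norm x"

definition positive_operator :: "'a::complex_normed_vector set \<Rightarrow> ('a \<Rightarrow> 'a) \<Rightarrow> bool"
  where "positive_operator C T \<longleftrightarrow> bounded_clinear T \<and> T ` C \<subseteq> C"

end

theory Submission
  imports Defs
begin

text \<open>Everything is read off from the part of the resolvent set where the resolvent is positive.
  Let \<open>A\<close> be the set of all \<open>t \<ge> 0\<close> for which \<open>t - T\<close> has a bounded inverse that maps the cone
  into itself, and let \<open>\<rho>\<close> be its infimum. The point is that \<open>\<rho>\<close> turns out to be the spectral
  radius. Three observations carry this.

  If \<open>t \<in> A\<close> with inverse \<open>R\<close>, then iterating \<open>t R x = x + T R x\<close> shows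
  \<open>0 \<le> T\<^sup>n x \<le> t\<^sup>n\<^sup>+\<^sup>1 R x\<close> for \<open>x\<close> in the cone. Normality turns this
  into a norm bound and generation spreads it to the whole space, so
  \<open>\<parallel>T\<^sup>n\<parallel> \<le> K t\<^sup>n\<close> (lemma \<open>power_bound_of_positive_resolvent\<close>). The
  Neumann series of \<open>T / z\<close> therefore converges for \<open>\<bar>z\<bar> > t\<close>, which places the spectrum in the
  disc of radius \<open>\<rho>\<close> and the whole half-line above \<open>\<rho>\<close> in \<open>A\<close>
  (lemma \<open>inverse_outside_disc\<close>).

  Membership in \<open>A\<close> extends to the left by a length controlled by the norm of the
  inverse (lemma \<open>positive_resolvent_step_left\<close>): for \<open>0 \<le> s \<le> t\<close> the Neumann series
  \<open>\<Sum>\<^sub>n (t - s)\<^sup>n R\<^sup>n\<^sup>+\<^sup>1\<close> has positive terms. Hence the norms of the positive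
  inverses cannot stay bounded as \<open>t\<close> decreases to \<open>\<rho>\<close>, for otherwise a point below \<open>\<rho>\<close>, or the
  point \<open>0\<close>, would belong to \<open>A\<close>; and \<open>0 \<in> A\<close> would mean that \<open>- T\<close> is inverse to a
  positive map, which pointedness forbids on a nonzero space.

  Finally, if \<open>T - \<rho>\<close> were bounded below on the cone, then so would be \<open>t - T\<close>, uniformly for
  \<open>t\<close> slightly above \<open>\<rho>\<close>, and the positive inverses would stay bounded. So there are
  normalized positive approximate eigenvectors for \<open>\<rho>\<close>; they force \<open>\<rho>\<close> into the spectrum,
  and as the spectrum lies in the disc of radius \<open>\<rho>\<close>, this number is the spectral radius.\<close>


section \<open>Bounded complex-linear operators\<close>

lemma bounded_clinear_bounded_linear: "bounded_clinear T \<Longrightarrow> bounded_linear T"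
  by (simp add: bounded_clinear_def)

lemma bounded_clinear_scaleC: "bounded_clinear T \<Longrightarrow> T (a *\<^sub>C x) = a *\<^sub>C T x"
  by (simp add: bounded_clinear_def)

lemma bounded_linear_scaleC: "bounded_linear (\<lambda>x::'a::complex_normed_vector. a *\<^sub>C x)"
proof (rule bounded_linear_intro[where K = "cmod a"])
  fix x y :: 'a and r :: real
  show "a *\<^sub>C (x + y) = a *\<^sub>C x + a *\<^sub>C y"
    by (rule scaleC_add_right)
  show "a *\<^sub>C (r *\<^sub>R x) = r *\<^sub>R (a *\<^sub>C x)"
    by (metis scaleC_of_real scaleC_scaleC mult.commute)
  show "norm (a *\<^sub>C x) \<le> norm x * cmod a"
    by (simp add: norm_scaleC mult.commute)
qed

lemma bounded_clinear_scaleC_self: "bounded_clinear (\<lambda>x::'a::complex_normed_vector. a *\<^sub>C x)"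
  by (simp add: bounded_clinear_def bounded_linear_scaleC scaleC_scaleC mult.commute)

lemma bounded_clinear_compose:
  "bounded_clinear S \<Longrightarrow> bounded_clinear T \<Longrightarrow> bounded_clinear (\<lambda>x. S (T x))"
  by (simp add: bounded_clinear_def bounded_linear_compose)

lemma bounded_clinear_funpow:
  fixes T :: "'a::complex_normed_vector \<Rightarrow> 'a"
  shows "bounded_clinear T \<Longrightarrow> bounded_clinear (T ^^ n)"
proof (induction n)
  case 0
  then show ?case
    by (simp add: bounded_clinear_def id_def)
next
  case (Suc n)
  then show ?case
    using bounded_clinear_compose[of T "T ^^ n"] by (simp add: o_def)
qed

lemma funpow_norm_le:
  fixes F :: "'a::real_normed_vector \<Rightarrow> 'a"
  assumes "\<And>x. norm (F x) \<le> q * norm x" and "0 \<le> q"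
  shows "norm ((F ^^ n) x) \<le> 1 * q ^ n * norm x"
proof (induction n)
  case (Suc n)
  have "norm ((F ^^ Suc n) x) \<le> q * norm ((F ^^ n) x)"
    using assms(1) by simp
  also have "\<dots> \<le> q * (1 * q ^ n * norm x)"
    using Suc assms(2) by (rule mult_left_mono)
  finally show ?case
    by (simp add: mult.assoc)
qed simp

lemma funpow_invariant: "F ` C \<subseteq> C \<Longrightarrow> x \<in> C \<Longrightarrow> (F ^^ n) x \<in> C"
  by (induction n) auto


section \<open>Inverses by Neumann series\<close>

definition is_inverse ::
    "('a::complex_normed_vector \<Rightarrow> 'a) \<Rightarrow> ('a \<Rightarrow> 'a) \<Rightarrow> bool"
  where "is_inverse A B \<longleftrightarrow> bounded_clinear B \<and> (\<forall>x. B (A x) = x) \<and> (\<forall>x. A (B x) = x)"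

lemma notin_op_spectrum_iff:
  "z \<notin> op_spectrum T \<longleftrightarrow> (\<exists>S. is_inverse (\<lambda>x. z *\<^sub>C x - T x) S)"
  by (simp add: op_spectrum_def is_inverse_def)

text \<open>The hypothesis is a geometric bound on the powers rather than \<open>\<parallel>F\<parallel> < 1\<close>, because
  positivity of an operator yields only bounds of this kind, with a constant \<open>K\<close> that
  usually exceeds 1.\<close>

lemma neumann_series:
  fixes F :: "'a::complex_banach \<Rightarrow> 'a"
  assumes F: "bounded_clinear F" and q: "0 \<le> q" "q < 1"
    and bound: "\<And>n x. norm ((F ^^ n) x) \<le> K * q ^ n * norm x"
  shows "\<exists>S. bounded_clinear S \<and> (\<forall>x. S (x - F x) = x) \<and> (\<forall>x. S x - F (S x) = x) \<and>
    (\<forall>C. closed C \<and> convex_cone C \<and> F ` C \<subseteq> C \<longrightarrow> S ` C \<subseteq> C)"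
proof -
  define S where "S x = (\<Sum>n. (F ^^ n) x)" for x
  have lin: "bounded_clinear (F ^^ n)" for n
    using F by (rule bounded_clinear_funpow)
  note blin = bounded_clinear_bounded_linear[OF lin]
  note Flin = bounded_clinear_bounded_linear[OF F]
  have geom: "summable (\<lambda>n. K * q ^ n * norm x)" for x :: 'a
    using q by (intro summable_mult summable_mult2 summable_geometric) simp
  have summ: "summable (\<lambda>n. (F ^^ n) x)" for x
    by (rule summable_comparison_test'[OF geom bound])
  have add: "S (x + y) = S x + S y" for x y
    unfolding S_def suminf_add[OF summ summ]
    by (simp add: linear_add[OF bounded_linear.linear[OF blin]])
  have scaleC: "S (a *\<^sub>C x) = a *\<^sub>C S x" for a x
    unfolding S_def bounded_linear.suminf[OF bounded_linear_scaleC summ]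
    by (simp add: bounded_clinear_scaleC[OF lin])
  have norm_le: "norm (S x) \<le> norm x * (K * (\<Sum>n. q ^ n))" for x
  proof -
    have "norm (S x) \<le> (\<Sum>n. K * q ^ n * norm x)"
      unfolding S_def by (rule norm_suminf_le[OF bound geom])
    also have "\<dots> = K * (\<Sum>n. q ^ n) * norm x"
      using q by (simp add: suminf_mult2[symmetric] suminf_mult summable_geometric summable_mult)
    finally show ?thesis
      by (simp add: mult_ac)
  qed
  have "bounded_linear S"
    by (rule bounded_linear_intro[OF add _ norm_le]) (metis scaleC scaleC_of_real)
  then have S: "bounded_clinear S"
    by (simp add: bounded_clinear_def scaleC)
  have right: "S x - F (S x) = x" for x
  proof -
    have "F (S x) = (\<Sum>n. (F ^^ Suc n) x)"
      unfolding S_def by (simp add: bounded_linear.suminf[OF Flin summ])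
    then show ?thesis
      using suminf_split_head[OF summ, of x] by (simp add: S_def)
  qed
  have "S (F x) = F (S x)" for x
    unfolding S_def bounded_linear.suminf[OF Flin summ]
    by (simp add: funpow_swap1)
  then have left: "S (x - F x) = x" for x
    using right[of x] by (simp add: linear_diff[OF bounded_linear.linear[OF \<open>bounded_linear S\<close>]])
  have pos: "S x \<in> C" if C: "closed C" "convex_cone C" "F ` C \<subseteq> C" "x \<in> C" for C x
  proof (rule closed_sequentially[OF C(1)])
    show "(\<lambda>n. \<Sum>i<n. (F ^^ i) x) \<longlonglongrightarrow> S x"
      unfolding S_def by (rule summable_LIMSEQ[OF summ])
    show "(\<Sum>i<n. (F ^^ i) x) \<in> C" for n
      by (induction n) (auto intro!: convex_cone_add[OF C(2)] funpow_invariant[OF C(3,4)]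
          simp: convex_cone_contains_0[OF C(2)])
  qed
  show ?thesis
    by (intro exI[of _ S] conjI allI impI image_subsetI) (auto intro: S left right pos)
qed

text \<open>Both uses of the Neumann series have this shape: the resolvent near infinity, where \<open>A\<close> is
  multiplication by a scalar, and the resolvent near a point of the resolvent set.\<close>

lemma is_inverse_factor:
  fixes A :: "'a::complex_banach \<Rightarrow> 'a"
  assumes AB: "is_inverse A B" and D: "\<And>x. D x = A (x - F x)"
    and F: "bounded_clinear F" and q: "0 \<le> q" "q < 1"
    and bound: "\<And>n x. norm ((F ^^ n) x) \<le> K * q ^ n * norm x"
  shows "\<exists>S. is_inverse D S \<and>
    (\<forall>C. closed C \<and> convex_cone C \<and> F ` C \<subseteq> C \<and> B ` C \<subseteq> C \<longrightarrow> S ` C \<subseteq> C)"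
proof -
  obtain N where N: "bounded_clinear N" "\<And>x. N (x - F x) = x" "\<And>x. N x - F (N x) = x"
    and pos: "\<forall>C. closed C \<and> convex_cone C \<and> F ` C \<subseteq> C \<longrightarrow> N ` C \<subseteq> C"
    using neumann_series[OF F q bound] by blast
  have "is_inverse D (\<lambda>x. N (B x))"
    using AB N by (auto simp: is_inverse_def D intro: bounded_clinear_compose)
  moreover have "(\<lambda>x. N (B x)) ` C \<subseteq> C"
    if "closed C" "convex_cone C" "F ` C \<subseteq> C" "B ` C \<subseteq> C" for C
    using pos[rule_format, of C] that by (auto simp: image_subset_iff)
  ultimately show ?thesis
    by blast
qed

lemma inverse_outside_disc:
  fixes T :: "'a::complex_banach \<Rightarrow> 'a"
  assumes T: "bounded_clinear T" and t: "0 \<le> t" "t < cmod z"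
    and bound: "\<And>n x. norm ((T ^^ n) x) \<le> K * t ^ n * norm x"
  shows "\<exists>S. is_inverse (\<lambda>x. z *\<^sub>C x - T x) S \<and>
    (z = complex_of_real (cmod z) \<longrightarrow>
      (\<forall>C. closed C \<and> convex_cone C \<and> T ` C \<subseteq> C \<longrightarrow> S ` C \<subseteq> C))"
proof -
  have z: "z \<noteq> 0"
    using t by auto
  define F where "F x = (1 / z) *\<^sub>C T x" for x
  have F: "bounded_clinear F"
    unfolding F_def[abs_def] by (rule bounded_clinear_compose[OF bounded_clinear_scaleC_self T])
  have Fn: "(F ^^ n) x = (1 / z ^ n) *\<^sub>C (T ^^ n) x" for n x
    by (induction n) (simp_all add: F_def scaleC_one scaleC_scaleC bounded_clinear_scaleC[OF T])
  have inv: "is_inverse (\<lambda>x::'a. z *\<^sub>C x) (\<lambda>x. (1 / z) *\<^sub>C x)"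
    using z by (simp add: is_inverse_def bounded_clinear_scaleC_self scaleC_scaleC scaleC_one)
  have D: "z *\<^sub>C x - T x = z *\<^sub>C (x - F x)" for x
    using z by (simp add: F_def linear_diff[OF bounded_linear.linear[OF bounded_linear_scaleC]]
        scaleC_scaleC scaleC_one)
  have Fbound: "norm ((F ^^ n) x) \<le> K * (t / cmod z) ^ n * norm x" for n x
    using bound[of n x] z
    by (simp add: Fn norm_scaleC norm_divide norm_power power_divide field_simps)
  have q: "0 \<le> t / cmod z" "t / cmod z < 1"
    using t by (simp_all add: divide_less_eq)
  obtain S where S: "is_inverse (\<lambda>x. z *\<^sub>C x - T x) S"
    and pos: "\<forall>C. closed C \<and> convex_cone C \<and> F ` C \<subseteq> C \<and> (\<lambda>x. (1 / z) *\<^sub>C x) ` C \<subseteq> C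
      \<longrightarrow> S ` C \<subseteq> C"
    using is_inverse_factor[OF inv D F q Fbound] by blast
  have "S ` C \<subseteq> C"
    if s: "z = complex_of_real (cmod z)" and C: "closed C" "convex_cone C" "T ` C \<subseteq> C" for C
  proof -
    have "(1 / z) *\<^sub>C x = (1 / cmod z) *\<^sub>R x" for x :: 'a
      by (subst s) (simp flip: scaleC_of_real)
    then have scaled: "(1 / z) *\<^sub>C x \<in> C" if "x \<in> C" for x
      using convex_cone_scaleR[OF C(2) _ that] by simp
    then have "F ` C \<subseteq> C"
      using C(3) by (auto simp: F_def image_subset_iff)
    then show ?thesis
      using pos C scaled by blast
  qed
  with S show ?thesis
    by blast
qed


section \<open>Positive inverses of \<open>t - T\<close>\<close>

definition positive_resolvent ::
    "'a::complex_normed_vector set \<Rightarrow> ('a \<Rightarrow> 'a) \<Rightarrow> real \<Rightarrow> ('a \<Rightarrow> 'a) \<Rightarrow> bool"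
  where "positive_resolvent C T t R \<longleftrightarrow>
    is_inverse (\<lambda>x. complex_of_real t *\<^sub>C x - T x) R \<and> R ` C \<subseteq> C"

lemma positive_resolventD:
  assumes "positive_resolvent C T t R"
  shows "bounded_clinear R" "R (t *\<^sub>R x - T x) = x" "t *\<^sub>R R x - T (R x) = x"
    "x \<in> C \<Longrightarrow> R x \<in> C"
  using assms by (auto simp: positive_resolvent_def is_inverse_def scaleC_of_real)

context ordered_banach_space
begin

lemma cone_scaleR: "x \<in> C \<Longrightarrow> 0 \<le> r \<Longrightarrow> r *\<^sub>R x \<in> C"
  using cone by (simp add: cone_def)

lemma convex_cone_C: "convex_cone C"
proof -
  have "0 \<in> C"
    using pointed by blast
  then show ?thesis
    by (simp add: convex_cone_iff add_closed cone_scaleR)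
qed

lemma bound_on_cone_extends:
  shows "\<exists>d>0. \<forall>(F :: 'a \<Rightarrow> 'a) K.
    bounded_clinear F \<and> 0 \<le> K \<and> (\<forall>x\<in>C. norm (F x) \<le> K * norm x)
      \<longrightarrow> (\<forall>x. norm (F x) \<le> d * K * norm x)"
proof -
  obtain d where d: "d > 0" and split: "\<And>x. \<exists>x1\<in>C. \<exists>x2\<in>C. \<exists>x3\<in>C. \<exists>x4\<in>C.
      x = x1 - x2 + \<i> *\<^sub>C (x3 - x4) \<and>
      norm x1 \<le> d * norm x \<and> norm x2 \<le> d * norm x \<and> norm x3 \<le> d * norm x \<and> norm x4 \<le> d * norm x"
    using generating by blast
  have "norm (F x) \<le> 4 * d * K * norm x"
    if F: "bounded_clinear F" and K: "0 \<le> K" and le: "\<And>x. x \<in> C \<Longrightarrow> norm (F x) \<le> K * norm x"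
    for F :: "'a \<Rightarrow> 'a" and K x
  proof -
    note lin = bounded_linear.linear[OF bounded_clinear_bounded_linear[OF F]]
    obtain x1 x2 x3 x4 where mem: "x1 \<in> C" "x2 \<in> C" "x3 \<in> C" "x4 \<in> C"
      and x: "x = x1 - x2 + \<i> *\<^sub>C (x3 - x4)"
      and n: "norm x1 \<le> d * norm x" "norm x2 \<le> d * norm x" "norm x3 \<le> d * norm x"
        "norm x4 \<le> d * norm x"
      using split[of x] by blast
    have part: "norm (F y) \<le> K * (d * norm x)" if "y \<in> C" "norm y \<le> d * norm x" for y
      using le[OF that(1)] mult_left_mono[OF that(2) K] by linarith
    have "F x = F x1 - F x2 + \<i> *\<^sub>C (F x3 - F x4)"
      by (subst x) (simp add: linear_add[OF lin] linear_diff[OF lin] bounded_clinear_scaleC[OF F])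
    then have "norm (F x) \<le> norm (F x1 - F x2) + norm (F x3 - F x4)"
      using norm_triangle_ineq[of "F x1 - F x2" "\<i> *\<^sub>C (F x3 - F x4)"] by (simp add: norm_scaleC)
    also have "\<dots> \<le> 4 * (K * (d * norm x))"
      using norm_triangle_ineq4[of "F x1" "F x2"] norm_triangle_ineq4[of "F x3" "F x4"]
        part[OF mem(1) n(1)] part[OF mem(2) n(2)] part[OF mem(3) n(3)] part[OF mem(4) n(4)]
      by linarith
    finally show ?thesis
      by (simp add: mult_ac)
  qed
  then show ?thesis
    using d by (intro exI[of _ "4 * d"]) simp
qed

text \<open>Each term of the formal expansion \<open>R = \<Sum>\<^sub>n T\<^sup>n / t\<^sup>n\<^sup>+\<^sup>1\<close> is dominated on the
  cone by the positive map \<open>R\<close>, whether or not the series converges.\<close>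

lemma power_bound_of_positive_resolvent:
  assumes T: "positive_operator C T" and R: "positive_resolvent C T t R" and t: "0 \<le> t"
  obtains K where "\<And>n x. norm ((T ^^ n) x) \<le> K * t ^ n * norm x"
proof -
  have Tlin: "bounded_clinear T" and TC: "T ` C \<subseteq> C"
    using T by (auto simp: positive_operator_def)
  note lin = bounded_linear.linear[OF bounded_clinear_bounded_linear[OF Tlin]]
  have dominated: "t ^ Suc n *\<^sub>R R x - (T ^^ n) x \<in> C" if "x \<in> C" for n x
  proof (induction n)
    case 0
    have "T (R x) \<in> C"
      using TC positive_resolventD(4)[OF R that] by auto
    moreover have "t *\<^sub>R R x - x = T (R x)"
      using positive_resolventD(3)[OF R, of x] by (simp add: algebra_simps)
    ultimately show ?case
      by simp
  next
    case (Suc n)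
    have "T (t ^ Suc n *\<^sub>R R x - (T ^^ n) x) + t ^ Suc n *\<^sub>R x \<in> C"
      using Suc TC that t by (intro add_closed cone_scaleR) auto
    moreover have "T (t ^ Suc n *\<^sub>R R x - (T ^^ n) x) + t ^ Suc n *\<^sub>R x
        = t ^ Suc n *\<^sub>R (T (R x) + x) - (T ^^ Suc n) x"
      by (simp only: linear_diff[OF lin] linear_scale[OF lin] scaleR_add_right funpow.simps o_apply)
        (simp add: algebra_simps)
    moreover have "T (R x) + x = t *\<^sub>R R x"
      using positive_resolventD(3)[OF R, of x] by (simp add: algebra_simps)
    ultimately show ?case
      by (simp add: mult_ac)
  qed
  obtain c where c: "c > 0" "\<And>x y. cone_le C 0 x \<Longrightarrow> cone_le C x y \<Longrightarrow> norm x \<le> c * norm y"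
    using normal by blast
  obtain B where B: "B > 0" "\<And>x. norm (R x) \<le> norm x * B"
    using bounded_linear.pos_bounded[OF bounded_clinear_bounded_linear[OF
          positive_resolventD(1)[OF R]]] by blast
  obtain d where d: "\<forall>(F :: 'a \<Rightarrow> 'a) K.
      bounded_clinear F \<and> 0 \<le> K \<and> (\<forall>x\<in>C. norm (F x) \<le> K * norm x)
        \<longrightarrow> (\<forall>x. norm (F x) \<le> d * K * norm x)"
    using bound_on_cone_extends by blast
  have on_cone: "norm ((T ^^ n) x) \<le> c * t ^ Suc n * B * norm x" if "x \<in> C" for n x
  proof -
    have "norm ((T ^^ n) x) \<le> c * norm (t ^ Suc n *\<^sub>R R x)"
      using dominated[OF that] funpow_invariant[OF TC that] by (intro c) (simp_all add: cone_le_def)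
    also have "\<dots> \<le> c * (t ^ Suc n * (norm x * B))"
      using t c(1) B(2)[of x] by (auto intro!: mult_left_mono simp: abs_mult)
    finally show ?thesis
      by (simp add: mult_ac)
  qed
  have "norm ((T ^^ n) x) \<le> d * (c * t ^ Suc n * B) * norm x" for n x
    using on_cone t c(1) B(1) by (intro d[rule_format] conjI bounded_clinear_funpow[OF Tlin]) auto
  then have "norm ((T ^^ n) x) \<le> (d * c * t * B) * t ^ n * norm x" for n x
    by (simp add: mult_ac)
  then show thesis
    by (rule that)
qed

text \<open>This is the perturbation series by which the resolvent set is open. Towards the left its
  terms are positive maps, because there the factor \<open>t - s\<close> in
  \<open>s - T = (t - T) (1 - (t - s) R)\<close> is nonnegative. The quantitative form matters: the step
  length depends on the bound \<open>M\<close> alone.\<close>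

lemma positive_resolvent_step_left:
  assumes T: "bounded_clinear T" and R: "positive_resolvent C T t R"
    and M: "\<And>x. norm (R x) \<le> M * norm x"
    and s: "s \<le> t" "(t - s) * M < 1" "0 \<le> M"
  obtains S where "positive_resolvent C T s S"
proof -
  define F where "F x = complex_of_real (t - s) *\<^sub>C R x" for x
  have inv: "is_inverse (\<lambda>x. complex_of_real t *\<^sub>C x - T x) R" and RC: "R ` C \<subseteq> C"
    using R by (auto simp: positive_resolvent_def)
  have F: "bounded_clinear F"
    unfolding F_def[abs_def]
    by (rule bounded_clinear_compose[OF bounded_clinear_scaleC_self positive_resolventD(1)[OF R]])
  have q: "0 \<le> (t - s) * M"
    using s by simp
  have "norm (F x) \<le> (t - s) * M * norm x" for x
    using mult_left_mono[OF M, of "t - s" x] s(1)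
    by (simp add: F_def norm_scaleC mult.assoc flip: of_real_diff)
  note bound = funpow_norm_le[OF this q]
  have FC: "F ` C \<subseteq> C"
    using RC s(1) by (auto simp: F_def scaleC_of_real image_subset_iff intro!: cone_scaleR
        simp flip: of_real_diff)
  have D: "complex_of_real s *\<^sub>C x - T x
      = complex_of_real t *\<^sub>C (x - F x) - T (x - F x)" for x
  proof -
    note lin = bounded_linear.linear[OF bounded_clinear_bounded_linear[OF T]]
    have "t *\<^sub>R (x - F x) - T (x - F x)
        = t *\<^sub>R x - T x - (t - s) *\<^sub>R (t *\<^sub>R R x - T (R x))"
      unfolding F_def scaleC_of_real
      by (simp add: linear_diff[OF lin] linear_add[OF lin] linear_scale[OF lin] algebra_simps)
    then show ?thesis
      by (simp add: scaleC_of_real positive_resolventD(3)[OF R] algebra_simps)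
  qed
  obtain S where "is_inverse (\<lambda>x. complex_of_real s *\<^sub>C x - T x) S" "S ` C \<subseteq> C"
    using is_inverse_factor[OF inv D F q s(2) bound] closed_cone convex_cone_C FC RC by metis
  then show thesis
    by (intro that) (simp add: positive_resolvent_def)
qed

lemma no_positive_resolvent_at_zero:
  assumes T: "positive_operator C T" and nonzero: "\<exists>x::'a. x \<noteq> 0"
  shows "\<not> positive_resolvent C T 0 R"
proof
  assume R: "positive_resolvent C T 0 R"
  have trivial: "x = 0" if "x \<in> C" for x
  proof -
    have "T (R x) \<in> C"
      using T positive_resolventD(4)[OF R that] by (auto simp: positive_operator_def)
    moreover have "x = - T (R x)"
      using positive_resolventD(3)[OF R, of x] by simp
    ultimately have "x \<in> C \<inter> uminus ` C"
      using that by blast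
    then show ?thesis
      using pointed by auto
  qed
  have "x = 0" for x :: 'a
  proof -
    obtain x1 x2 x3 x4 where mem: "x1 \<in> C" "x2 \<in> C" "x3 \<in> C" "x4 \<in> C"
      and x: "x = x1 - x2 + \<i> *\<^sub>C (x3 - x4)"
      using generating by metis
    show ?thesis
      unfolding x mem[THEN trivial] by (simp flip: norm_eq_zero add: norm_scaleC)
  qed
  with nonzero show False
    by blast
qed

lemma positive_resolvent_above:
  assumes T: "positive_operator C T" and t: "0 \<le> t" "t < s"
    and bound: "\<And>n x. norm ((T ^^ n) x) \<le> K * t ^ n * norm x"
  obtains R where "positive_resolvent C T s R"
proof -
  have Tlin: "bounded_clinear T" and TC: "T ` C \<subseteq> C"
    using T by (auto simp: positive_operator_def)
  have "t < cmod (complex_of_real s)"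
    using t by simp
  then obtain S where "is_inverse (\<lambda>x. complex_of_real s *\<^sub>C x - T x) S" "S ` C \<subseteq> C"
    using inverse_outside_disc[OF Tlin t(1) _ bound, of "complex_of_real s"]
      t closed_cone convex_cone_C TC by auto
  then show thesis
    by (intro that) (simp add: positive_resolvent_def)
qed


section \<open>The infimum of the positive resolvent set\<close>

definition positive_resolvent_set :: "('a \<Rightarrow> 'a) \<Rightarrow> real set"
  where "positive_resolvent_set T = {t. 0 \<le> t \<and> (\<exists>R. positive_resolvent C T t R)}"

lemma positive_resolvent_set_nonempty:
  assumes T: "positive_operator C T"
  shows "positive_resolvent_set T \<noteq> {}"
proof -
  have "bounded_linear T"
    using T by (simp add: positive_operator_def bounded_clinear_def)
  then obtain q where q: "0 < q" "\<And>x. norm (T x) \<le> norm x * q"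
    using bounded_linear.pos_bounded by blast
  have "norm ((T ^^ n) x) \<le> 1 * q ^ n * norm x" for n x
    using q by (intro funpow_norm_le) (simp_all add: mult.commute)
  moreover have "0 \<le> q" "q < q + 1"
    using q by auto
  ultimately obtain R where "positive_resolvent C T (q + 1) R"
    using positive_resolvent_above[OF T] by metis
  then have "q + 1 \<in> positive_resolvent_set T"
    using q by (auto simp: positive_resolvent_set_def)
  then show ?thesis
    by blast
qed

lemma bdd_below_positive_resolvent_set: "bdd_below (positive_resolvent_set T)"
  by (rule bdd_belowI[of _ 0]) (simp add: positive_resolvent_set_def)

lemma power_bound_above_Inf:
  assumes T: "positive_operator C T" and s: "Inf (positive_resolvent_set T) < s"
  obtains t K where "0 \<le> t" "t < s" "\<And>n x. norm ((T ^^ n) x) \<le> K * t ^ n * norm x"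
proof -
  obtain t where "t \<in> positive_resolvent_set T" "t < s"
    using cInf_lessD[OF positive_resolvent_set_nonempty[OF T] s] by blast
  then show thesis
    using power_bound_of_positive_resolvent[OF T] that
    by (auto simp: positive_resolvent_set_def) metis
qed

lemma spectrum_in_disc:
  assumes T: "positive_operator C T" and z: "z \<in> op_spectrum T"
  shows "cmod z \<le> Inf (positive_resolvent_set T)"
proof (rule ccontr)
  assume "\<not> ?thesis"
  then obtain t K where t: "0 \<le> t" "t < cmod z"
    and bound: "\<And>n x. norm ((T ^^ n) x) \<le> K * t ^ n * norm x"
    using power_bound_above_Inf[OF T, of "cmod z"] by auto
  have "bounded_clinear T"
    using T by (simp add: positive_operator_def)
  from inverse_outside_disc[OF this t bound] z show False
    by (metis notin_op_spectrum_iff)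
qed

text \<open>If \<open>T - \<rho>\<close> is bounded below by \<open>\<epsilon>\<close> on the cone, then \<open>t - T\<close> is bounded below by
  \<open>\<epsilon> / 2\<close> there for \<open>\<rho> < t \<le> \<rho> + \<epsilon> / 2\<close>. The positive inverses at these \<open>t\<close> then share a
  norm bound, and a step to the left from a \<open>t\<close> close enough to \<open>\<rho>\<close> passes \<open>\<rho>\<close> or
  reaches \<open>0\<close>.\<close>

lemma approximate_eigenvector_at_Inf:
  assumes T: "positive_operator C T" and nonzero: "\<exists>x::'a. x \<noteq> 0" and e: "0 < e"
  defines "\<rho> \<equiv> Inf (positive_resolvent_set T)"
  obtains x where "x \<in> C" "norm x = 1" "norm (T x - \<rho> *\<^sub>R x) < e"
proof (rule ccontr)
  assume "\<not> thesis"
  then have unit: "e \<le> norm (T x - \<rho> *\<^sub>R x)" if "x \<in> C" "norm x = 1" for x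
    using that \<open>\<And>x. \<lbrakk>x \<in> C; norm x = 1; norm (T x - \<rho> *\<^sub>R x) < e\<rbrakk> \<Longrightarrow> thesis\<close> by force
  have Tlin: "bounded_clinear T"
    using T by (simp add: positive_operator_def)
  note lin = bounded_linear.linear[OF bounded_clinear_bounded_linear[OF Tlin]]
  have below: "e * norm x \<le> norm (T x - \<rho> *\<^sub>R x)" if x: "x \<in> C" for x
  proof (cases "x = 0")
    case False
    have "T ((1 / norm x) *\<^sub>R x) - \<rho> *\<^sub>R (1 / norm x) *\<^sub>R x = (1 / norm x) *\<^sub>R (T x - \<rho> *\<^sub>R x)"
      by (simp add: linear_scale[OF lin] algebra_simps)
    moreover have "e \<le> norm (T ((1 / norm x) *\<^sub>R x) - \<rho> *\<^sub>R (1 / norm x) *\<^sub>R x)"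
      using False cone_scaleR[OF x, of "1 / norm x"] by (intro unit) simp_all
    ultimately have "e \<le> (1 / norm x) * norm (T x - \<rho> *\<^sub>R x)"
      by simp
    then show ?thesis
      using False by (simp add: field_simps)
  qed simp
  have rho: "0 \<le> \<rho>"
    unfolding \<rho>_def using positive_resolvent_set_nonempty[OF T]
    by (rule cInf_greatest) (simp add: positive_resolvent_set_def)
  obtain d where d: "d > 0"
    and extends: "\<forall>(F :: 'a \<Rightarrow> 'a) K.
      bounded_clinear F \<and> 0 \<le> K \<and> (\<forall>x\<in>C. norm (F x) \<le> K * norm x)
        \<longrightarrow> (\<forall>x. norm (F x) \<le> d * K * norm x)"
    using bound_on_cone_extends by blast
  define M where "M = d * (2 / e)"
  have M: "0 < M"
    using d e by (simp add: M_def)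
  \<comment> \<open>Both \<open>t\<close> and the target \<open>s\<close> below lie within \<open>1 / (4 * M)\<close> of \<open>\<rho>\<close>, so that the step
    from \<open>t\<close> to \<open>s\<close> stays in the reach \<open>1 / M\<close> of the perturbation series.\<close>
  define t where "t = \<rho> + min (e / 2) (1 / (4 * M))"
  have t: "\<rho> < t" "t \<le> \<rho> + e / 2" "t \<le> \<rho> + 1 / (4 * M)"
    using e M by (auto simp: t_def)
  obtain R where R: "positive_resolvent C T t R"
    using power_bound_above_Inf[OF T t(1)[unfolded \<rho>_def]] positive_resolvent_above[OF T] by metis
  have "norm (R x) \<le> 2 / e * norm x" if x: "x \<in> C" for x
  proof -
    have "T (R x) - \<rho> *\<^sub>R R x = (t - \<rho>) *\<^sub>R R x - x"
      using positive_resolventD(3)[OF R, of x] by (simp add: algebra_simps)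
    then have "e * norm (R x) \<le> norm ((t - \<rho>) *\<^sub>R R x - x)"
      using below[OF positive_resolventD(4)[OF R x]] by simp
    also have "\<dots> \<le> (t - \<rho>) * norm (R x) + norm x"
      using norm_triangle_ineq4[of "(t - \<rho>) *\<^sub>R R x" x] t by simp
    also have "\<dots> \<le> e / 2 * norm (R x) + norm x"
      using t by (intro add_mono mult_right_mono) auto
    finally show ?thesis
      using e by (simp add: field_simps)
  qed
  then have RM: "norm (R x) \<le> M * norm x" for x
    unfolding M_def using e positive_resolventD(1)[OF R] by (intro extends[rule_format]) auto
  define s where "s = max 0 (\<rho> - 1 / (4 * M))"
  have s: "s \<le> t" "t - s \<le> 1 / (2 * M)"
  proof -
    have "0 < 1 / (4 * M)" "1 / (2 * M) = 2 * (1 / (4 * M))"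
      using M by simp_all
    then show "s \<le> t" "t - s \<le> 1 / (2 * M)"
      using t rho by (auto simp: s_def)
  qed
  have "(t - s) * M \<le> 1 / (2 * M) * M"
    using s M by (intro mult_right_mono) auto
  then have "(t - s) * M < 1"
    using M by simp
  then obtain S where S: "positive_resolvent C T s S"
    using positive_resolvent_step_left[OF Tlin R RM s(1)] M by auto
  then have "\<rho> \<le> s"
    unfolding \<rho>_def
    by (intro cInf_lower bdd_below_positive_resolvent_set) (auto simp: positive_resolvent_set_def s_def)
  then have "s = 0"
    using M by (auto simp: s_def max_def split: if_splits)
  with S show False
    using no_positive_resolvent_at_zero[OF T nonzero] by simp
qed

end

lemma approximate_eigenvalue_in_op_spectrum:
  assumes "\<And>e. 0 < e \<Longrightarrow> \<exists>x. norm x = 1 \<and> norm (T x - z *\<^sub>C x) < e"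
  shows "z \<in> op_spectrum T"
proof (rule ccontr)
  assume "z \<notin> op_spectrum T"
  then obtain S where S: "bounded_linear S" "\<And>x. S (z *\<^sub>C x - T x) = x"
    by (auto simp: op_spectrum_def bounded_clinear_def)
  obtain B where B: "B > 0" "\<And>x. norm (S x) \<le> norm x * B"
    using bounded_linear.pos_bounded[OF S(1)] by blast
  obtain x where x: "norm x = 1" "norm (T x - z *\<^sub>C x) < 1 / B"
    using assms[of "1 / B"] B(1) by auto
  have "norm x \<le> norm (T x - z *\<^sub>C x) * B"
    using B(2)[of "z *\<^sub>C x - T x"] by (simp add: S(2) norm_minus_commute)
  also have "\<dots> < 1"
    using x(2) B(1) by (simp add: field_simps)
  finally show False
    using x(1) by simp
qed

theorem theorem4p7:
  fixes C :: "'a::complex_banach set" and T :: "'a \<Rightarrow> 'a"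
  assumes "ordered_banach_space C"
    and "\<exists>x::'a. x \<noteq> 0"
    and "positive_operator C T"
  shows "complex_of_real (op_spectral_radius T) \<in> op_spectrum T \<and>
    (\<exists>x::nat \<Rightarrow> 'a. (\<forall>n. x n \<in> C \<and> norm (x n) = 1) \<and>
      (\<lambda>n. norm (T (x n) - op_spectral_radius T *\<^sub>R x n)) \<longlonglongrightarrow> 0)"
proof -
  interpret ordered_banach_space C
    by (rule assms(1))
  define \<rho> where "\<rho> = Inf (positive_resolvent_set T)"
  have approx: "\<exists>x. x \<in> C \<and> norm x = 1 \<and> norm (T x - \<rho> *\<^sub>R x) < e" if "0 < e" for e
    using approximate_eigenvector_at_Inf[OF assms(3,2) that] unfolding \<rho>_def by metis
  have in_spectrum: "complex_of_real \<rho> \<in> op_spectrum T"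
    using approx by (intro approximate_eigenvalue_in_op_spectrum) (auto simp: scaleC_of_real)
  have "0 \<le> \<rho>"
    unfolding \<rho>_def using positive_resolvent_set_nonempty[OF assms(3)]
    by (rule cInf_greatest) (simp add: positive_resolvent_set_def)
  then have radius: "op_spectral_radius T = \<rho>"
    unfolding op_spectral_radius_def using in_spectrum spectrum_in_disc[OF assms(3)]
    by (intro cSup_eq_maximum) (force simp: \<rho>_def)+
  have "\<forall>n. \<exists>x. x \<in> C \<and> norm x = 1 \<and> norm (T x - \<rho> *\<^sub>R x) < inverse (real (Suc n))"
    by (intro allI approx) simp
  then obtain x where x: "\<And>n. x n \<in> C" "\<And>n. norm (x n) = 1"
    "\<And>n. norm (T (x n) - \<rho> *\<^sub>R x n) < inverse (real (Suc n))"
    by metis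
  have "(\<lambda>n. norm (T (x n) - \<rho> *\<^sub>R x n)) \<longlonglongrightarrow> 0"
    by (rule tendsto_sandwich[OF _ _ tendsto_const LIMSEQ_inverse_real_of_nat])
      (intro always_eventually allI norm_ge_zero less_imp_le[OF x(3)])+
  with x in_spectrum show ?thesis
    unfolding radius by blast
qed

end
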